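(* Let $f\in C^1([0,1])$ be such that $\int_0^1 f(x)\,dx=1$. Then for every positive integer $p$ and every $x\in[0,1]$, $$(\mathscr{G}_p^n f)(x)=\eta_p(x)+O(Q_p^n)\qquad (n\to\infty).$$ That is, for every positive integer $p$ and every $x\in[0,1]$ there is a constant $C$ (which may depend on $f$, $p$ and $x$ but not on $n$) such that $|(\mathscr{G}_p^n f)(x)-\eta_p(x)|\le C\,Q_p^n$ for all $n\ge 0$.
   Context: $C^1([0,1])$ is the space of real-valued continuously differentiable functions on $[0,1]$. For a positive integer $p$, $\mathscr{G}_p$ is the transfer operator of the generalized Gauss transformation $T_p(x)=\{p/x\}$ ($x\ne0$), $T_p(0)=0$, on $[0,1]$ (where $\{\cdot\}$ is the fractional part), given by $$(\mathscr{G}_p f)(x)=\sum_{k=p}^\infty\frac{p}{(k+x)^2}\,f\Big(\frac{p}{k+x}\Big),\qquad x\in[0,1],$$ and $\mathscr{G}_p^n$ denotes its $n$-fold iterate. Further, $$\eta_p(x)=\frac{1}{\ln(p+1)-\ln p}\cdot\frac{1}{p+x},\qquad Q_p=2p^2\zeta(3,p)-p\,\zeta(2,p),$$ where $\zeta(2,p)=\sum_{k=p}^\infty \frac{1}{k^2}$ and $\zeta(3,p)=\sum_{k=p}^\infty\frac{1}{k^3}$. *)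

theory Defs
  imports "HOL-Analysis.Analysis"
begin

text \<open>
  Functions on \<open>[0,1]\<close> are represented by total functions \<open>real \<Rightarrow> real\<close>; only their
  values on \<open>{0..1}\<close> matter. Derivatives are taken within \<open>{0..1}\<close>, hence are one-sided
  at the two endpoints; the library notion \<open>C1_differentiable_on\<close> would instead require
  two-sided derivatives there.
\<close>

definition C1_unit_interval :: "(real \<Rightarrow> real) \<Rightarrow> bool" where
  "C1_unit_interval f \<longleftrightarrow>
     (\<exists>f'. (\<forall>x\<in>{0..1}. (f has_real_derivative f' x) (at x within {0..1})) \<and>
           continuous_on {0..1} f')"

text \<open>
  In the series below, the summation index \<open>k\<close> running from \<open>p\<close> to infinity is written as
  \<open>p + j\<close> with \<open>j \<ge> 0\<close>. For \<open>p \<ge> 1\<close> and \<open>x \<in> [0,1]\<close> all points \<open>p / (k + x)\<close> lie in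
  \<open>(0,1]\<close>, so the restriction to \<open>[0,1]\<close> of the image under \<open>gauss_transfer p\<close> depends only
  on the restriction of \<open>f\<close>, and the series converges absolutely for bounded \<open>f\<close>.
\<close>

definition gauss_transfer :: "nat \<Rightarrow> (real \<Rightarrow> real) \<Rightarrow> real \<Rightarrow> real" where
  "gauss_transfer p f x =
     (\<Sum>j. real p / (real (p + j) + x)\<^sup>2 * f (real p / (real (p + j) + x)))"

definition gauss_density :: "nat \<Rightarrow> real \<Rightarrow> real" where
  "gauss_density p x = 1 / (ln (real p + 1) - ln (real p)) * (1 / (real p + x))"

definition hurwitz_zeta :: "nat \<Rightarrow> nat \<Rightarrow> real" where
  "hurwitz_zeta s p = (\<Sum>j. 1 / real (p + j) ^ s)"

definition Q_const :: "nat \<Rightarrow> real" where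
  "Q_const p = 2 * (real p)\<^sup>2 * hurwitz_zeta 3 p - real p * hurwitz_zeta 2 p"

end

theory Submission
  imports Defs "HOL-Real_Asymp.Real_Asymp"
begin

text \<open>
  Multiplying by \<open>p + x\<close>, the reciprocal of the invariant density up to a constant, turns the
  transfer operator into a Markov operator \<open>U\<close>: the value \<open>U g x\<close> is the mean of \<open>g\<close> over the
  points \<open>p / (k + x)\<close>, \<open>k \<ge> p\<close>, with weights
  \<open>(p + x) / ((k + x) (k + x + 1))\<close> that add up to 1. The density corresponds to a constant
  function, so the theorem says that \<open>g = (p + x) f\<close> flattens out under \<open>U\<close> at rate \<open>Q\<^sub>p\<close>.

  The reason is that \<open>U\<close> reverses monotonicity. When \<open>x\<close> grows, every point \<open>p / (k + x)\<close> moves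
  down, and the weight moves towards larger \<open>k\<close>, hence also down
  (\<open>gauss_markov_antimono\<close>). If \<open>g\<close> is \<open>L\<close>-Lipschitz, then \<open>L t + g t\<close> and \<open>L t - g t\<close> are
  nondecreasing, so their images are nonincreasing; that is, \<open>U g\<close> cannot vary faster than
  \<open>L\<close> times the image of the identity. Only this one image has to be computed. With \<open>q = p + x\<close> and
  the Hurwitz zeta function it equals \<open>p (q \<zeta>(2,q) - 1)\<close>, whose negated slope is
  \<open>p (2 q \<zeta>(3,q) - \<zeta>(2,q))\<close>. At \<open>q = p\<close> this is exactly \<open>Q\<^sub>p\<close>, and it is the largest value
  because \<open>q \<zeta>(2,q)\<close> is convex for \<open>q \<ge> 1\<close> (\<open>Polygamma_convexity\<close>). Therefore \<open>U\<close> multiplies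
  Lipschitz constants by at most \<open>Q\<^sub>p\<close> (\<open>gauss_markov_lipschitz\<close>).

  It remains to identify the constant that the iterates approach. The transfer operator preserves
  integrals (\<open>has_integral_gauss_transfer\<close>), so the mean of \<open>U\<^sup>n g\<close> with respect to the invariant
  probability density is the same for all \<open>n\<close>; a function with Lipschitz constant \<open>L Q\<^sub>p\<^sup>n\<close> on the unit
  interval stays within \<open>L Q\<^sub>p\<^sup>n\<close> of its mean (\<open>weighted_mean_close\<close>).
\<close>

section \<open>The Markov operator conjugate to the transfer operator\<close>

definition inverse_branch :: "nat \<Rightarrow> nat \<Rightarrow> real \<Rightarrow> real" where
  "inverse_branch p j x = real p / (real (p + j) + x)"

definition branch_weight :: "nat \<Rightarrow> nat \<Rightarrow> real \<Rightarrow> real" where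
  "branch_weight p j x = (real p + x) / ((real (p + j) + x) * (real (p + j) + x + 1))"

definition gauss_markov :: "nat \<Rightarrow> (real \<Rightarrow> real) \<Rightarrow> real \<Rightarrow> real" where
  "gauss_markov p g x = (\<Sum>j. branch_weight p j x * g (inverse_branch p j x))"

lemma inverse_branch_in_unit_interval:
  assumes "p \<ge> 1" "x \<ge> 0"
  shows "inverse_branch p j x \<in> {0..1}"
  using assms by (auto simp: inverse_branch_def divide_simps)

lemma inverse_branch_antimono:
  assumes "p \<ge> 1" "0 \<le> x" "x \<le> y"
  shows "inverse_branch p j y \<le> inverse_branch p j x"
  using assms unfolding inverse_branch_def by (intro divide_left_mono mult_pos_pos) auto

lemma inverse_branch_Suc_le:
  assumes "p \<ge> 1" "0 \<le> x"
  shows "inverse_branch p (Suc j) x \<le> inverse_branch p j x"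
  using assms unfolding inverse_branch_def by (intro divide_left_mono mult_pos_pos) auto

lemma continuous_on_inverse_branch:
  assumes "p \<ge> 1"
  shows "continuous_on {0..1} (inverse_branch p j)"
  unfolding inverse_branch_def using assms by (intro continuous_intros) auto

lemma branch_weight_nonneg: "p \<ge> 1 \<Longrightarrow> x \<ge> 0 \<Longrightarrow> branch_weight p j x \<ge> 0"
  by (simp add: branch_weight_def)

text \<open>
  The tail \<open>(p + x) / (p + N + x)\<close> left over by the first \<open>N\<close> weights increases with \<open>x\<close>. This is
  the stochastic ordering behind the order reversal.
\<close>

lemma sum_branch_weight:
  assumes "p \<ge> 1" "x \<ge> 0"
  shows "(\<Sum>j<N. branch_weight p j x) = 1 - (real p + x) / (real (p + N) + x)"
proof -
  define r where "r j = (real p + x) / (real (p + j) + x)" for j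
  have "branch_weight p j x = r j - r (Suc j)" for j
  proof -
    have "real (p + j) + x > 0" using assms by auto
    then show ?thesis
      by (simp add: branch_weight_def r_def divide_simps) (simp add: algebra_simps)
  qed
  then have "(\<Sum>j<N. branch_weight p j x) = r 0 - r N"
    by (simp add: sum_lessThan_telescope')
  moreover have "r 0 = 1"
    using assms by (simp add: r_def)
  ultimately show ?thesis by (simp add: r_def)
qed

lemma branch_weight_sums:
  assumes "p \<ge> 1" "x \<ge> 0"
  shows "(\<lambda>j. branch_weight p j x) sums 1"
proof -
  have "(\<lambda>N. (real p + x) / (real (p + N) + x)) \<longlonglongrightarrow> 0"
    by real_asymp
  from tendsto_diff[OF tendsto_const[of 1] this] show ?thesis
    unfolding sums_def sum_branch_weight[OF assms] by simp
qed

lemma gauss_markov_sums: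
  assumes "p \<ge> 1" "x \<ge> 0" and g: "bounded (g ` {0..1})"
  shows "(\<lambda>j. branch_weight p j x * g (inverse_branch p j x)) sums gauss_markov p g x"
proof -
  obtain B where B: "\<And>t. t \<in> {0..1} \<Longrightarrow> \<bar>g t\<bar> \<le> B"
    using g unfolding bounded_iff by (metis imageI real_norm_def)
  have "summable (\<lambda>j. branch_weight p j x * g (inverse_branch p j x))"
  proof (rule summable_comparison_test')
    show "summable (\<lambda>j. branch_weight p j x * B)"
      using branch_weight_sums[OF assms(1,2)] by (intro summable_mult2) (rule sums_summable)
    show "norm (branch_weight p j x * g (inverse_branch p j x)) \<le> branch_weight p j x * B" for j
      using B[OF inverse_branch_in_unit_interval[OF assms(1,2)]] branch_weight_nonneg[OF assms(1,2)]
      by (simp add: abs_mult mult_left_mono)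
  qed
  then show ?thesis
    unfolding gauss_markov_def by (rule summable_sums)
qed

lemma gauss_markov_linear:
  assumes "p \<ge> 1" "x \<ge> 0" "bounded (g ` {0..1})" "bounded (h ` {0..1})"
  shows "gauss_markov p (\<lambda>t. a * g t + b * h t) x = a * gauss_markov p g x + b * gauss_markov p h x"
proof -
  have "(\<lambda>j. a * (branch_weight p j x * g (inverse_branch p j x))
            + b * (branch_weight p j x * h (inverse_branch p j x)))
        sums (a * gauss_markov p g x + b * gauss_markov p h x)"
    by (intro sums_add sums_mult gauss_markov_sums assms)
  then show ?thesis
    unfolding gauss_markov_def by (auto simp: sums_iff algebra_simps)
qed

text \<open>
  Each term transforms separately, since \<open>p + p / y = p (y + 1) / y\<close> for \<open>y = k + x\<close> cancels the factor
  \<open>y + 1\<close> in the denominator of the weight.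
\<close>

lemma gauss_transfer_conjugate:
  assumes "p \<ge> 1" "x \<ge> 0" and f: "bounded (f ` {0..1})"
  shows "(real p + x) * gauss_transfer p f x = gauss_markov p (\<lambda>t. (real p + t) * f t) x"
proof -
  have b: "bounded ((\<lambda>t. (real p + t) * f t) ` {0..1})"
  proof -
    obtain B where B: "\<And>t. t \<in> {0..1} \<Longrightarrow> \<bar>f t\<bar> \<le> B"
      using f unfolding bounded_iff by (metis imageI real_norm_def)
    have "\<bar>(real p + t) * f t\<bar> \<le> (real p + 1) * B" if "t \<in> {0..1}" for t
      using that B[OF that] by (auto simp: abs_mult intro!: mult_mono)
    then show ?thesis unfolding bounded_iff by (auto intro!: exI[of _ "(real p + 1) * B"])
  qed
  have eq: "1 / (real p + x) * (branch_weight p j x * ((real p + inverse_branch p j x) * f (inverse_branch p j x)))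
     = real p / (real (p + j) + x)\<^sup>2 * f (inverse_branch p j x)" for j
  proof -
    have "real (p + j) + x > 0" "real p + x > 0" using assms by auto
    then have *: "1 / (real p + x) * branch_weight p j x * (real p + inverse_branch p j x)
        = real p / (real (p + j) + x)\<^sup>2"
      unfolding branch_weight_def inverse_branch_def power2_eq_square
      by (simp add: divide_simps) (simp add: algebra_simps)
    show ?thesis unfolding *[symmetric] by (simp only: mult.assoc)
  qed
  have "(\<lambda>j. real p / (real (p + j) + x)\<^sup>2 * f (inverse_branch p j x)) sums
          (1 / (real p + x) * gauss_markov p (\<lambda>t. (real p + t) * f t) x)"
    using sums_mult[OF gauss_markov_sums[OF assms(1,2) b], of "1 / (real p + x)"]
    unfolding eq .
  then have "gauss_transfer p f x = 1 / (real p + x) * gauss_markov p (\<lambda>t. (real p + t) * f t) x"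
    unfolding gauss_transfer_def inverse_branch_def by (rule sums_unique[symmetric])
  moreover have "real p + x \<noteq> 0" using assms by auto
  ultimately show ?thesis by simp
qed

section \<open>Order reversal\<close>

text \<open>
  Summation by parts, in the form that lets a sequence \<open>d\<close> of mixed sign be handled by its partial
  sums alone.
\<close>

lemma Abel_sum_lower_bound:
  fixes a d :: "nat \<Rightarrow> real"
  assumes D: "\<And>n. (\<Sum>k<n. d k) \<ge> 0" and a: "\<And>k. a (Suc k) \<le> a k"
  shows "(\<Sum>k<n. d k * a k) \<ge> (\<Sum>k<n. d k) * a n"
proof (induction n)
  case (Suc n)
  have "(\<Sum>k<Suc n. d k) * a (Suc n) \<le> (\<Sum>k<Suc n. d k) * a n"
    by (intro mult_left_mono a D)
  also have "\<dots> = (\<Sum>k<n. d k) * a n + d n * a n"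
    by (simp add: algebra_simps)
  also have "\<dots> \<le> (\<Sum>k<Suc n. d k * a k)"
    using Suc by simp
  finally show ?case .
qed simp

text \<open>
  Passing from \<open>x\<close> to \<open>y\<close> is split into two steps, neither of which increases the mean: the weights change from
  those of \<open>x\<close> to those of \<open>y\<close> while the points stay at \<open>p / (k + x)\<close>, and then the points move
  down to \<open>p / (k + y)\<close>. The first step is summation by parts against the tails of the weights.
\<close>

lemma gauss_markov_antimono:
  assumes p: "p \<ge> 1" and xy: "0 \<le> x" "x \<le> y" and g: "mono_on {0..1} g"
  shows "gauss_markov p g y \<le> gauss_markov p g x"
proof -
  have y: "0 \<le> y" using xy by simp
  have gb: "g 0 \<le> g t \<and> g t \<le> g 1" if "t \<in> {0..1}" for t
    using that g by (auto simp: monotone_on_def)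
  have bd: "bounded (g ` {0..1})"
    by (rule bounded_subset[of "{g 0..g 1}"]) (use gb in auto)
  note in01 = inverse_branch_in_unit_interval[OF p]
  define d where "d j = branch_weight p j x - branch_weight p j y" for j
  define a where "a j = g (inverse_branch p j x)" for j
  have D: "(\<Sum>k<n. d k) = (real p + y) / (real (p + n) + y) - (real p + x) / (real (p + n) + x)" for n
    unfolding d_def sum_subtractf sum_branch_weight[OF p xy(1)] sum_branch_weight[OF p y] by simp
  have D0: "(\<Sum>k<n. d k) \<ge> 0" for n
  proof -
    have "real n * x \<le> real n * y" using xy by (intro mult_left_mono) auto
    moreover have "real (p + n) + y > 0" "real (p + n) + x > 0" using p xy y by auto
    ultimately show ?thesis
      unfolding D by (simp add: divide_simps) (simp add: algebra_simps)
  qed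
  have "(\<lambda>j. branch_weight p j x * a j - branch_weight p j y * a j)
      sums (gauss_markov p g x - (\<Sum>j. branch_weight p j y * a j))"
  proof (intro sums_diff)
    show "(\<lambda>j. branch_weight p j x * a j) sums gauss_markov p g x"
      unfolding a_def by (rule gauss_markov_sums[OF p xy(1) bd])
    have "summable (\<lambda>j. branch_weight p j y * a j)"
    proof (rule summable_comparison_test')
      show "summable (\<lambda>j. branch_weight p j y * (\<bar>g 0\<bar> + \<bar>g 1\<bar>))"
        using branch_weight_sums[OF p y] by (intro summable_mult2) (rule sums_summable)
      show "norm (branch_weight p j y * a j) \<le> branch_weight p j y * (\<bar>g 0\<bar> + \<bar>g 1\<bar>)" for j
        using gb[OF in01[OF xy(1), of j]] branch_weight_nonneg[OF p y, of j]
        by (auto simp: abs_mult a_def intro!: mult_left_mono)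
    qed
    then show "(\<lambda>j. branch_weight p j y * a j) sums (\<Sum>j. branch_weight p j y * a j)"
      by (rule summable_sums)
  qed
  then have S: "(\<lambda>j. d j * a j) sums (gauss_markov p g x - (\<Sum>j. branch_weight p j y * a j))"
    by (simp add: d_def algebra_simps)
  \<comment> \<open>The partial sums of \<open>d\<close> tend to 0, so with any lower bound for \<open>a\<close> the boundary term of the
     summation by parts disappears in the limit.\<close>
  have "(\<lambda>n. (\<Sum>k<n. d k) * - (\<bar>g 0\<bar> + \<bar>g 1\<bar>)) \<longlonglongrightarrow> 0 * - (\<bar>g 0\<bar> + \<bar>g 1\<bar>)"
    unfolding D by (intro tendsto_mult tendsto_const) real_asymp
  moreover have "(\<Sum>k<n. d k) * - (\<bar>g 0\<bar> + \<bar>g 1\<bar>) \<le> (\<Sum>k<n. d k * a k)" for n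
  proof -
    have "(\<Sum>k<n. d k) * - (\<bar>g 0\<bar> + \<bar>g 1\<bar>) \<le> (\<Sum>k<n. d k) * a n"
      using gb[OF in01[OF xy(1), of n]] by (intro mult_left_mono D0) (auto simp: a_def)
    also have "\<dots> \<le> (\<Sum>k<n. d k * a k)"
    proof (rule Abel_sum_lower_bound[OF D0])
      show "a (Suc k) \<le> a k" for k
        unfolding a_def using inverse_branch_Suc_le[OF p xy(1)] in01[OF xy(1)] g
        by (auto simp: monotone_on_def)
    qed
    finally show ?thesis .
  qed
  ultimately have 1: "0 \<le> gauss_markov p g x - (\<Sum>j. branch_weight p j y * a j)"
    using S unfolding sums_def by (intro LIMSEQ_le) auto
  have "gauss_markov p g y \<le> (\<Sum>j. branch_weight p j y * a j)"
  proof (rule sums_le)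
    show "(\<lambda>j. branch_weight p j y * g (inverse_branch p j y)) sums gauss_markov p g y"
      by (rule gauss_markov_sums[OF p y bd])
    \<comment> \<open>The terms are those with the weights of \<open>y\<close> and the points of \<open>x\<close>.\<close>
    have "summable (\<lambda>j. branch_weight p j x * a j - d j * a j)"
      using gauss_markov_sums[OF p xy(1) bd] S unfolding a_def
      by (intro summable_diff) (auto simp: sums_iff)
    then show "(\<lambda>j. branch_weight p j y * a j) sums (\<Sum>j. branch_weight p j y * a j)"
      by (intro summable_sums) (simp add: d_def algebra_simps)
    show "branch_weight p j y * g (inverse_branch p j y) \<le> branch_weight p j y * a j" for j
      unfolding a_def using inverse_branch_antimono[OF p xy] in01[OF xy(1)] in01[OF y] g
      by (intro mult_left_mono branch_weight_nonneg p y) (auto simp: monotone_on_def)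
  qed
  with 1 show ?thesis by simp
qed

section \<open>The image of the identity\<close>

text \<open>
  Up to a factor the polygamma functions of positive order are the Hurwitz zeta functions \<open>\<zeta>(s,q)\<close> of a real second
  argument, and unlike termwise series they come with their derivatives.
\<close>

lemma inverse_power_sums_Polygamma:
  fixes q :: real
  assumes "q > 0"
  shows "(\<lambda>j. 1 / (q + real j)^2) sums Polygamma 1 q"
    and "(\<lambda>j. 1 / (q + real j)^3) sums (- Polygamma 2 q / 2)"
    and "(\<lambda>j. 1 / (q + real j)^4) sums (Polygamma 3 q / 6)"
proof -
  have S: "(\<lambda>j. 1 / (q + real j) ^ Suc n) sums ((-1) ^ Suc n * Polygamma n q / fact n)" if "n > 0" for n
    using Polygamma_LIMSEQ[of q n] assms that by (simp add: inverse_eq_divide)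
  show "(\<lambda>j. 1 / (q + real j)^2) sums Polygamma 1 q"
    using S[of 1] by (simp add: numeral_2_eq_2)
  show "(\<lambda>j. 1 / (q + real j)^3) sums (- Polygamma 2 q / 2)"
    using S[of 2] by (simp add: fact_numeral)
  show "(\<lambda>j. 1 / (q + real j)^4) sums (Polygamma 3 q / 6)"
    using S[of 3] by (simp add: fact_numeral)
qed

text \<open>
  The left-hand side is the second derivative of \<open>q \<zeta>(2,q)\<close>, namely \<open>6 q \<zeta>(4,q) - 4 \<zeta>(3,q)\<close>. The
  leading terms \<open>2 / q\<^sup>2\<close> of the two parts cancel, so a crude comparison with integrals does not
  decide the sign.
\<close>

lemma Polygamma_convexity:
  fixes q :: real
  assumes q: "q \<ge> 1"
  shows "2 * Polygamma 2 q + q * Polygamma 3 q \<ge> 0"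
proof -
  \<comment> \<open>By the first terms of the Euler-Maclaurin expansion, \<open>\<zeta>(4,y)\<close> is close to
     \<open>1/(3 y\<^sup>3) + 1/(2 y^4)\<close> from above, and \<open>\<zeta>(3,y)\<close> is close to \<open>1/(2 y\<^sup>2) + 1/(2 y\<^sup>3) + 1/(4 y^4)\<close>
     from below. \<open>E\<close> is \<open>6 q\<close> times the first minus 4 times the second.\<close>
  define E where "E y = q * (2*y + 3) / y^4 - (2*y^2 + 2*y + 1) / y^4" for y :: real
  have step: "E y - E (y + 1) \<le> 6 * q * (1 / y^4) - 4 * (1 / y^3)" if y: "y > 0" for y
  proof -
    have A: "(2*y + 3) / y^4 - (2*(y+1) + 3) / (y+1)^4 \<le> 6 * (1 / y^4)"
    proof -
      have "6 * (y+1)^4 - ((2*y+3) * (y+1)^4 - (2*(y+1)+3) * y^4) = 10*y^2 + 10*y + 3"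
        by algebra
      moreover have "10*y^2 + 10*y + 3 \<ge> 0" using y by simp
      ultimately have "(2*y+3) * (y+1)^4 - (2*(y+1)+3) * y^4 \<le> 6 * (y+1)^4"
        by linarith
      then have "((2*y+3) * (y+1)^4 - (2*(y+1)+3) * y^4) / (y^4 * (y+1)^4)
          \<le> 6 * (y+1)^4 / (y^4 * (y+1)^4)"
        using y by (intro divide_right_mono) auto
      moreover have "6 * (y+1)^4 / (y^4 * (y+1)^4) = 6 * (1 / y^4)"
        using y by simp
      moreover have "((2*y+3) * (y+1)^4 - (2*(y+1)+3) * y^4) / (y^4 * (y+1)^4)
         = (2*y + 3) / y^4 - (2*(y+1) + 3) / (y+1)^4"
        using y by (subst diff_divide_distrib) simp
      ultimately show ?thesis by simp
    qed
    have B: "4 * (1 / y^3) \<le> (2*y^2 + 2*y + 1) / y^4 - (2*(y+1)^2 + 2*(y+1) + 1) / (y+1)^4"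
    proof -
      have "(2*y^2 + 2*y + 1) * (y+1)^4 - (2*(y+1)^2 + 2*(y+1) + 1) * y^4 - 4 * y * (y+1)^4 = 2*y + 1"
        by algebra
      then have "4 * y * (y+1)^4 \<le> (2*y^2 + 2*y + 1) * (y+1)^4 - (2*(y+1)^2 + 2*(y+1) + 1) * y^4"
        using y by linarith
      then have "4 * y * (y+1)^4 / (y^4 * (y+1)^4)
        \<le> ((2*y^2 + 2*y + 1) * (y+1)^4 - (2*(y+1)^2 + 2*(y+1) + 1) * y^4) / (y^4 * (y+1)^4)"
        using y by (intro divide_right_mono) auto
      moreover have "4 * y * (y+1)^4 / (y^4 * (y+1)^4) = 4 * (1 / y^3)"
        using y by (simp add: numeral_eq_Suc)
      moreover have "((2*y^2 + 2*y + 1) * (y+1)^4 - (2*(y+1)^2 + 2*(y+1) + 1) * y^4) / (y^4 * (y+1)^4)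
         = (2*y^2 + 2*y + 1) / y^4 - (2*(y+1)^2 + 2*(y+1) + 1) / (y+1)^4"
        using y by (subst diff_divide_distrib) simp
      ultimately show ?thesis by simp
    qed
    from mult_left_mono[OF A, of q] q
    have "q * ((2*y + 3) / y^4 - (2*(y+1) + 3) / (y+1)^4) \<le> 6 * q * (1 / y^4)"
      by (simp add: mult_ac)
    with B show ?thesis
      unfolding E_def by (simp add: right_diff_distrib)
  qed
  have "(\<lambda>j. E (q + real j)) \<longlonglongrightarrow> 0"
    unfolding E_def by real_asymp
  from telescope_sums'[OF this]
  have T: "(\<lambda>j. E (q + real j) - E (q + real j + 1)) sums E q"
    by (simp add: add_ac)
  have "(\<lambda>j. 6 * q * (1 / (q + real j)^4) - 4 * (1 / (q + real j)^3)) sums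
        (6 * q * (Polygamma 3 q / 6) - 4 * (- Polygamma 2 q / 2))"
    using q by (intro sums_diff sums_mult inverse_power_sums_Polygamma) auto
  then have "E q \<le> 6 * q * (Polygamma 3 q / 6) - 4 * (- Polygamma 2 q / 2)"
    using step q by (intro sums_le[OF _ T]) auto
  moreover have "E q \<ge> 0"
  proof -
    have "E q = (q - 1) / q^4"
      unfolding E_def by (simp add: diff_divide_distrib[symmetric] power2_eq_square algebra_simps)
    then show ?thesis using q by simp
  qed
  ultimately show ?thesis by simp
qed

text \<open>
  A convex function lies above its tangent direction to the right: from \<open>a\<close> on, every slope of
  \<open>q \<zeta>(2,q)\<close> is at least the derivative at \<open>a\<close>.
\<close>

lemma mult_Polygamma_slope:
  fixes a x y :: real
  assumes "1 \<le> a" "a \<le> x" "x \<le> y"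
  shows "x * Polygamma 1 x - y * Polygamma 1 y \<le> - (Polygamma 1 a + a * Polygamma 2 a) * (y - x)"
proof (cases "x = y")
  case False
  have pos: "z \<notin> \<int>\<^sub>\<le>\<^sub>0" if "z \<ge> 1" for z :: real
    using that nonpos_Ints_nonpos[of z] by auto
  have d1: "((\<lambda>z. z * Polygamma 1 z) has_real_derivative Polygamma 1 z + z * Polygamma 2 z) (at z)"
    if "z \<ge> 1" for z
    using pos[OF that] by (auto intro!: derivative_eq_intros simp: numeral_2_eq_2)
  have d2: "((\<lambda>z. Polygamma 1 z + z * Polygamma 2 z) has_real_derivative
              2 * Polygamma 2 z + z * Polygamma 3 z) (at z)"
    if "z \<ge> 1" for z
    using pos[OF that] by (auto intro!: derivative_eq_intros simp: numeral_eq_Suc)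
  obtain z where z: "x < z" "z < y"
    "y * Polygamma 1 y - x * Polygamma 1 x = (y - x) * (Polygamma 1 z + z * Polygamma 2 z)"
    using MVT2[of x y "\<lambda>z. z * Polygamma 1 z" "\<lambda>z. Polygamma 1 z + z * Polygamma 2 z"] d1 assms False
    by force
  have "Polygamma 1 a + a * Polygamma 2 a \<le> Polygamma 1 z + z * Polygamma 2 z"
  proof (rule DERIV_nonneg_imp_nondecreasing[where f = "\<lambda>z. Polygamma 1 z + z * Polygamma 2 z"])
    show "a \<le> z" using z assms by simp
    show "\<exists>D. ((\<lambda>z. Polygamma 1 z + z * Polygamma 2 z) has_real_derivative D) (at t) \<and> D \<ge> 0"
      if "a \<le> t" for t
      using d2[of t] Polygamma_convexity[of t] that assms by auto
  qed
  then have "(y - x) * (Polygamma 1 a + a * Polygamma 2 a) \<le> (y - x) * (Polygamma 1 z + z * Polygamma 2 z)"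
    using assms by (intro mult_left_mono) auto
  then show ?thesis using z(3) by (simp add: algebra_simps)
qed simp

text \<open>
  The summand \<open>q p / (y\<^sup>2 (y + 1))\<close> is \<open>p\<close> times the difference of \<open>q / y\<^sup>2\<close> and the weight
  \<open>q / (y (y + 1))\<close>, and the weights add up to 1.
\<close>

lemma gauss_markov_id:
  assumes p: "p \<ge> 1" and x: "x \<ge> 0"
  shows "gauss_markov p (\<lambda>t. t) x = real p * ((real p + x) * Polygamma 1 (real p + x) - 1)"
proof -
  define q where "q = real p + x"
  have q: "q > 0" using assms by (simp add: q_def)
  have "(\<lambda>j. real p * (q * (1 / (q + real j)^2) - branch_weight p j x))
      sums (real p * (q * Polygamma 1 q - 1))"
    using q by (intro sums_mult sums_diff inverse_power_sums_Polygamma branch_weight_sums assms)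
  moreover have "real p * (q * (1 / (q + real j)^2) - branch_weight p j x)
       = branch_weight p j x * inverse_branch p j x" for j
  proof -
    have y: "q + real j > 0" "real (p + j) + x = q + real j" "real p + x = q"
      using q by (auto simp: q_def)
    show ?thesis
      unfolding branch_weight_def inverse_branch_def y(2,3) power2_eq_square using y(1)
      by (simp add: divide_simps) (simp add: algebra_simps)
  qed
  ultimately show ?thesis
    unfolding gauss_markov_def q_def by (simp add: sums_iff)
qed

lemma Q_const_eq_Polygamma:
  assumes "p \<ge> 1"
  shows "Q_const p = - real p * (Polygamma 1 (real p) + real p * Polygamma 2 (real p))"
proof -
  have "hurwitz_zeta 2 p = Polygamma 1 (real p)" "hurwitz_zeta 3 p = - Polygamma 2 (real p) / 2"
    using inverse_power_sums_Polygamma(1,2)[of "real p"] assms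
    unfolding hurwitz_zeta_def of_nat_add by (auto simp only: sums_iff of_nat_0_less_iff)
  then show ?thesis
    by (simp only: Q_const_def) (simp add: power2_eq_square distrib_left)
qed

lemma gauss_markov_id_slope:
  assumes p: "p \<ge> 1" and xy: "0 \<le> x" "x \<le> y"
  shows "gauss_markov p (\<lambda>t. t) x - gauss_markov p (\<lambda>t. t) y \<le> Q_const p * (y - x)"
proof -
  have "gauss_markov p (\<lambda>t. t) x - gauss_markov p (\<lambda>t. t) y
      = real p * ((real p + x) * Polygamma 1 (real p + x) - (real p + y) * Polygamma 1 (real p + y))"
    unfolding gauss_markov_id[OF p xy(1)] gauss_markov_id[OF p order_trans[OF xy]]
    by (simp add: right_diff_distrib)
  also have "\<dots> \<le> real p * (- (Polygamma 1 (real p) + real p * Polygamma 2 (real p)) * ((real p + y) - (real p + x)))"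
    using xy p by (intro mult_left_mono mult_Polygamma_slope) auto
  also have "\<dots> = Q_const p * (y - x)"
    by (simp add: Q_const_eq_Polygamma[OF p] algebra_simps)
  finally show ?thesis .
qed

section \<open>Contraction of Lipschitz constants\<close>

text \<open>
  The slope of the antitone image of the identity is at most 0 and at least \<open>- Q_const p\<close>.
\<close>

lemma Q_const_nonneg:
  assumes p: "p \<ge> 1"
  shows "Q_const p \<ge> 0"
proof -
  have "gauss_markov p (\<lambda>t. t) 1 \<le> gauss_markov p (\<lambda>t. t) 0"
    by (rule gauss_markov_antimono[OF p]) (auto simp: monotone_on_def)
  with gauss_markov_id_slope[OF p, of 0 1] show ?thesis by simp
qed

text \<open>
  Order reversal applied to \<open>L t + g t\<close> and \<open>L t - g t\<close>; the identity is the extremal function.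
\<close>

lemma gauss_markov_lipschitz:
  assumes p: "p \<ge> 1" and g: "L-lipschitz_on {0..1} g"
  shows "(L * Q_const p)-lipschitz_on {0..1} (gauss_markov p g)"
proof (rule lipschitz_on_leI)
  have L: "L \<ge> 0" by (rule lipschitz_on_nonneg[OF g])
  show "0 \<le> L * Q_const p" using L Q_const_nonneg[OF p] by simp
  fix x y :: real assume xy: "x \<in> {0..1}" "y \<in> {0..1}" "x \<le> y"
  have bd: "bounded (g ` {0..1})"
    using lipschitz_on_continuous_on[OF g] compact_continuous_image compact_Icc
    by (intro compact_imp_bounded) blast
  have bid: "bounded ((\<lambda>t. t) ` {0..1::real})" by simp
  have key: "s * (gauss_markov p g y - gauss_markov p g x) \<le> L * Q_const p * (y - x)"
    if s: "s = 1 \<or> s = -1" for s :: real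
  proof -
    have "mono_on {0..1} (\<lambda>t. L * t + s * g t)"
    proof (rule mono_onI)
      fix r t :: real assume rt: "r \<in> {0..1}" "t \<in> {0..1}" "r \<le> t"
      have "\<bar>g r - g t\<bar> \<le> L * (t - r)"
        using lipschitz_onD[OF g rt(1,2)] rt(3) by (simp add: dist_real_def)
      then show "L * r + s * g r \<le> L * t + s * g t"
        using s by (auto simp: algebra_simps abs_le_iff)
    qed
    from gauss_markov_antimono[OF p _ xy(3) this] xy
    have "L * gauss_markov p (\<lambda>t. t) y + s * gauss_markov p g y
        \<le> L * gauss_markov p (\<lambda>t. t) x + s * gauss_markov p g x"
      by (simp add: gauss_markov_linear[OF p _ bid bd])
    then have "s * (gauss_markov p g y - gauss_markov p g x)
        \<le> L * (gauss_markov p (\<lambda>t. t) x - gauss_markov p (\<lambda>t. t) y)"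
      by (simp add: algebra_simps)
    also have "\<dots> \<le> L * (Q_const p * (y - x))"
      using xy by (intro mult_left_mono gauss_markov_id_slope p L) auto
    finally show ?thesis by (simp add: mult_ac)
  qed
  show "dist (gauss_markov p g x) (gauss_markov p g y) \<le> L * Q_const p * dist x y"
    using key[of 1] key[of "-1"] xy(3) by (simp add: dist_real_def abs_le_iff)
qed

section \<open>Conservation of the integral\<close>

text \<open>
  The substitution \<open>t = p / (k + x)\<close>: the branches map \<open>[0,1]\<close> onto adjacent intervals that
  together fill \<open>(0,1]\<close>.
\<close>

lemma has_integral_gauss_transfer_term:
  assumes p: "p \<ge> 1" and f: "continuous_on {0..1} f"
  shows "((\<lambda>x. real p / (real (p + j) + x)\<^sup>2 * f (inverse_branch p j x)) has_integral
            (integral {real p / real (p + Suc j)..real p / real (p + j)} f)) {0..1}"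
proof -
  have le: "real p / real (p + Suc j) < real p / real (p + j)"
    using p by (intro divide_strict_left_mono) auto
  \<comment> \<open>The branch is decreasing, so of the two integrals one has an empty domain.\<close>
  have "((\<lambda>x. (- real p / (real (p + j) + x)\<^sup>2) *\<^sub>R f (inverse_branch p j x)) has_integral
      (integral {inverse_branch p j 0..inverse_branch p j 1} f
       - integral {inverse_branch p j 1..inverse_branch p j 0} f)) {0..1}"
  proof (rule has_integral_substitution_general[of "{}"])
    show "inverse_branch p j ` {0..1} \<subseteq> {0..1}"
      using inverse_branch_in_unit_interval[OF p] by auto
    show "continuous_on {0..1} (inverse_branch p j)"
      by (rule continuous_on_inverse_branch[OF p])
    show "(inverse_branch p j has_real_derivative - real p / (real (p + j) + x)\<^sup>2) (at x within {0..1})"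
      if "x \<in> {0..1} - {}" for x
      unfolding inverse_branch_def using p that
      by (auto intro!: derivative_eq_intros simp: power2_eq_square)
  qed (use f in auto)
  from has_integral_neg[OF this] le show ?thesis
    by (simp add: inverse_branch_def add_ac)
qed

text \<open>
  The series converges uniformly, and the integrals of its partial sums telescope to the integral of
  \<open>f\<close> from \<open>p / (p + N)\<close> to 1.
\<close>

lemma has_integral_gauss_transfer:
  assumes p: "p \<ge> 1" and f: "continuous_on {0..1} f"
  shows "(gauss_transfer p f has_integral integral {0..1} f) {0..1}"
proof -
  define tm where "tm j x = real p / (real (p + j) + x)\<^sup>2 * f (inverse_branch p j x)" for j x
  have "bounded (f ` {0..1})"
    using f compact_continuous_image compact_Icc by (intro compact_imp_bounded) blast
  then obtain B where B: "\<And>t. t \<in> {0..1} \<Longrightarrow> \<bar>f t\<bar> \<le> B"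
    unfolding bounded_iff by (metis imageI real_norm_def)
  have "uniform_limit {0..1} (\<lambda>N x. \<Sum>j<N. tm j x) (\<lambda>x. \<Sum>j. tm j x) sequentially"
  proof (rule Weierstrass_m_test)
    show "norm (tm j x) \<le> real p * (1 / (real p + real j)\<^sup>2) * B" if "x \<in> {0..1}" for j x
    proof -
      have "real p / (real (p + j) + x)\<^sup>2 \<le> real p * (1 / (real p + real j)\<^sup>2)"
        using p that by (auto intro!: divide_left_mono power_mono mult_pos_pos)
      moreover have "\<bar>f (inverse_branch p j x)\<bar> \<le> B"
        using B[OF inverse_branch_in_unit_interval[OF p, of x j]] that by simp
      ultimately have "real p / (real (p + j) + x)\<^sup>2 * \<bar>f (inverse_branch p j x)\<bar>
          \<le> real p * (1 / (real p + real j)\<^sup>2) * B"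
        by (intro mult_mono) auto
      then show ?thesis
        unfolding tm_def by (simp only: real_norm_def abs_mult abs_divide abs_power2 abs_of_nat)
    qed
    show "summable (\<lambda>j. real p * (1 / (real p + real j)\<^sup>2) * B)"
      using inverse_power_sums_Polygamma(1)[of "real p"] p
      by (intro summable_mult summable_mult2) (auto simp: sums_iff)
  qed
  moreover have "continuous_on {0..1} (\<lambda>x. \<Sum>j<N. tm j x)" for N
    unfolding tm_def
    using p inverse_branch_in_unit_interval[OF p]
    by (intro continuous_intros continuous_on_compose2[OF f continuous_on_inverse_branch]) auto
  ultimately obtain I J where I: "\<And>N. ((\<lambda>x. \<Sum>j<N. tm j x) has_integral I N) {0..1}"
    and J: "((\<lambda>x. \<Sum>j. tm j x) has_integral J) {0..1}" and IJ: "I \<longlonglongrightarrow> J"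
    by (rule uniform_limit_integral) auto
  define F where "F t = integral {0..t} f" for t
  have int: "f integrable_on {0..1}" by (rule integrable_continuous_interval[OF f])
  have I_eq: "I = (\<lambda>N. integral {0..1} f - F (real p / real (p + N)))"
  proof
    fix N
    have "((\<lambda>x. \<Sum>j<N. tm j x) has_integral (\<Sum>j<N. F (real p / real (p + j)) - F (real p / real (p + Suc j)))) {0..1}"
    proof (intro has_integral_sum)
      fix j
      have "F (real p / real (p + Suc j)) + integral {real p / real (p + Suc j)..real p / real (p + j)} f
          = F (real p / real (p + j))"
        unfolding F_def using p
        by (intro Henstock_Kurzweil_Integration.integral_combine integrable_on_subinterval[OF int])
           (auto intro!: divide_left_mono mult_pos_pos)
      then have "F (real p / real (p + j)) - F (real p / real (p + Suc j))
         = integral {real p / real (p + Suc j)..real p / real (p + j)} f" by simp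
      with has_integral_gauss_transfer_term[OF p f, of j]
      show "(tm j has_integral F (real p / real (p + j)) - F (real p / real (p + Suc j))) {0..1}"
        unfolding tm_def by simp
    qed simp
    with I have "I N = (\<Sum>j<N. F (real p / real (p + j)) - F (real p / real (p + Suc j)))"
      by (rule has_integral_unique)
    also have "\<dots> = F (real p / real (p + 0)) - F (real p / real (p + N))"
      by (rule sum_lessThan_telescope')
    also have "real p / real (p + 0) = 1" using p by simp
    also have "F 1 = integral {0..1} f" by (simp only: F_def)
    finally show "I N = integral {0..1} f - F (real p / real (p + N))" .
  qed
  have "(\<lambda>N. integral {0..1} f - F (real p / real (p + N))) \<longlonglongrightarrow> integral {0..1} f - F 0"
  proof (intro tendsto_intros)
    have "continuous_on {0..1} F"
      unfolding F_def by (rule indefinite_integral_continuous_1[OF int])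
    moreover have "(\<lambda>N. real p / real (p + N)) \<longlonglongrightarrow> 0" by real_asymp
    ultimately show "(\<lambda>N. F (real p / real (p + N))) \<longlonglongrightarrow> F 0"
      using p by (elim continuous_on_tendsto_compose) auto
  qed
  moreover have "F 0 = 0" by (simp add: F_def)
  ultimately have "I \<longlonglongrightarrow> integral {0..1} f" unfolding I_eq by (simp only: diff_zero)
  then have "J = integral {0..1} f"
    by (rule LIMSEQ_unique[OF IJ])
  with J show ?thesis
    unfolding tm_def gauss_transfer_def inverse_branch_def by simp
qed

section \<open>Convergence to the invariant density\<close>

lemma has_integral_inverse_shift:
  fixes p :: real
  assumes "p > 0"
  shows "((\<lambda>x. 1 / (p + x)) has_integral (ln (p + 1) - ln p)) {0..1}"
proof -
  have "((\<lambda>x. 1 / (p + x)) has_integral (ln (p + 1) - ln (p + 0))) {0..1}"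
    using assms by (intro fundamental_theorem_of_calculus)
      (auto intro!: derivative_eq_intros simp: has_real_derivative_iff_has_vector_derivative[symmetric])
  then show ?thesis by simp
qed

text \<open>
  On an interval of length 1 a function differs from its value at \<open>x\<close> by at most its Lipschitz
  constant. Here \<open>1 / (ln (p + 1) - ln p)\<close> is the mean of \<open>h\<close> for the probability density
  proportional to \<open>1 / (p + t)\<close>.
\<close>

lemma weighted_mean_close:
  fixes p :: real
  assumes p: "p > 0" and h: "L-lipschitz_on {0..1} h"
    and I: "((\<lambda>t. h t / (p + t)) has_integral 1) {0..1}" and x: "x \<in> {0..1}"
  shows "\<bar>h x - 1 / (ln (p + 1) - ln p)\<bar> \<le> L"
proof -
  define l where "l = ln (p + 1) - ln p"
  have l: "l > 0" using p by (simp add: l_def)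
  have L: "L \<ge> 0" by (rule lipschitz_on_nonneg[OF h])
  have hx: "\<bar>h t - h x\<bar> \<le> L" if "t \<in> {0..1}" for t
  proof -
    have "\<bar>h t - h x\<bar> \<le> L * \<bar>t - x\<bar>"
      using lipschitz_onD[OF h that x] by (simp add: dist_real_def)
    also have "\<dots> \<le> L * 1" using that x L by (intro mult_left_mono) auto
    finally show ?thesis by simp
  qed
  have int: "((\<lambda>t. c * (1 / (p + t))) has_integral c * l) {0..1}" for c
    unfolding l_def by (intro has_integral_mult_right has_integral_inverse_shift p)
  have "1 \<le> (h x + L) * l"
  proof (rule has_integral_le[OF I int])
    show "h t / (p + t) \<le> (h x + L) * (1 / (p + t))" if "t \<in> {0..1}" for t
      using hx[OF that] that p by (auto simp: divide_simps)
  qed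
  moreover have "(h x - L) * l \<le> 1"
  proof (rule has_integral_le[OF int I])
    show "(h x - L) * (1 / (p + t)) \<le> h t / (p + t)" if "t \<in> {0..1}" for t
      using hx[OF that] that p by (auto simp: divide_simps)
  qed
  ultimately have "1 / l \<le> h x + L" "h x - L \<le> 1 / l"
    using l by (simp_all add: divide_simps mult_ac)
  then show ?thesis unfolding l_def by (simp add: abs_le_iff)
qed

lemma C1_unit_interval_imp_lipschitz:
  assumes "C1_unit_interval f"
  obtains L where "L-lipschitz_on {0..1} f"
proof -
  obtain f' where f': "\<And>x. x \<in> {0..1} \<Longrightarrow> (f has_real_derivative f' x) (at x within {0..1})"
    and c: "continuous_on {0..1} f'"
    using assms unfolding C1_unit_interval_def by blast
  have "bounded (f' ` {0..1})"
    using c compact_continuous_image compact_Icc by (intro compact_imp_bounded) blast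
  then obtain B where B: "\<And>t. t \<in> {0..1} \<Longrightarrow> norm (f' t) \<le> B"
    unfolding bounded_iff by (metis imageI real_norm_def)
  have "B-lipschitz_on {0..1} f"
  proof (rule lipschitz_onI)
    show "0 \<le> B" using B[of 0] by (auto intro: order_trans[OF norm_ge_zero])
    show "dist (f x) (f y) \<le> B * dist x y" if "x \<in> {0..1}" "y \<in> {0..1}" for x y
      using field_differentiable_bound[of "{0..1}" f f' B x y] f' B that
      by (simp add: dist_norm)
  qed
  then show thesis by (rule that)
qed

lemma C1_unit_interval_linear_mult:
  assumes "C1_unit_interval f"
  shows "C1_unit_interval (\<lambda>x. (a + x) * f x)"
proof -
  obtain f' where f': "\<And>x. x \<in> {0..1} \<Longrightarrow> (f has_real_derivative f' x) (at x within {0..1})"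
    and c: "continuous_on {0..1} f'"
    using assms unfolding C1_unit_interval_def by blast
  have "continuous_on {0..1} f" using f' by (rule DERIV_continuous_on)
  then have "continuous_on {0..1} (\<lambda>x. f x + (a + x) * f' x)"
    by (intro continuous_intros c)
  moreover have "((\<lambda>x. (a + x) * f x) has_real_derivative f x + (a + x) * f' x) (at x within {0..1})"
    if "x \<in> {0..1}" for x
    using f'[OF that] by (auto intro!: derivative_eq_intros)
  ultimately show ?thesis
    unfolding C1_unit_interval_def
    by (intro exI[of _ "\<lambda>x. f x + (a + x) * f' x"] conjI ballI)
qed

text \<open>
  The two facts are proved together because preservation of the integral needs continuity of the
  iterate, which comes from its Lipschitz bound.
\<close>

lemma gauss_transfer_iterates:
  assumes p: "p \<ge> 1" and h: "L-lipschitz_on {0..1} (\<lambda>x. (real p + x) * f x)"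
  shows "(L * Q_const p ^ n)-lipschitz_on {0..1} (\<lambda>x. (real p + x) * (gauss_transfer p ^^ n) f x)
       \<and> ((gauss_transfer p ^^ n) f has_integral integral {0..1} f) {0..1}"
proof -
  have cont: "continuous_on {0..1} g" if "M-lipschitz_on {0..1} (\<lambda>x. (real p + x) * g x)" for M g
  proof -
    have "continuous_on {0..1} (\<lambda>x. (real p + x) * g x / (real p + x))"
      using p by (intro continuous_intros lipschitz_on_continuous_on[OF that]) auto
    then show ?thesis
      using p by (subst (asm) continuous_on_cong[OF refl, of _ _ g]) (auto simp: add_eq_0_iff)
  qed
  show ?thesis
  proof (induction n)
    case 0
    with h cont[OF h] show ?case by (auto intro: integrable_integral integrable_continuous_interval)
  next
    case (Suc n)
    define g where "g = (gauss_transfer p ^^ n) f"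
    have gL: "(L * Q_const p ^ n)-lipschitz_on {0..1} (\<lambda>x. (real p + x) * g x)"
      and gI: "integral {0..1} g = integral {0..1} f"
      using Suc unfolding g_def by auto
    have gc: "continuous_on {0..1} g" by (rule cont[OF gL])
    then have "bounded (g ` {0..1})"
      using compact_continuous_image compact_Icc by (intro compact_imp_bounded) blast
    then have eq: "(real p + x) * gauss_transfer p g x = gauss_markov p (\<lambda>t. (real p + t) * g t) x"
      if "x \<in> {0..1}" for x
      using gauss_transfer_conjugate[OF p] that by auto
    have "(L * Q_const p ^ n * Q_const p)-lipschitz_on {0..1} (\<lambda>x. (real p + x) * gauss_transfer p g x)"
      using gauss_markov_lipschitz[OF p gL] by (rule lipschitz_on_transform) (simp add: eq)
    moreover have "(gauss_transfer p g has_integral integral {0..1} f) {0..1}"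
      using has_integral_gauss_transfer[OF p gc] gI by simp
    ultimately show ?case by (simp add: g_def mult_ac)
  qed
qed

theorem theorem2:
  fixes f :: "real \<Rightarrow> real"
  assumes "C1_unit_interval f"
    and "integral {0..1} f = 1"
  shows "\<forall>p::nat. p \<ge> 1 \<longrightarrow> (\<forall>x\<in>{0..1}. \<exists>C::real. \<forall>n::nat.
           \<bar>(gauss_transfer p ^^ n) f x - gauss_density p x\<bar> \<le> C * Q_const p ^ n)"
proof (intro allI impI ballI)
  fix p :: nat and x :: real
  assume p: "p \<ge> 1" and x: "x \<in> {0..1}"
  obtain L where L: "L-lipschitz_on {0..1} (\<lambda>x. (real p + x) * f x)"
    using C1_unit_interval_imp_lipschitz[OF C1_unit_interval_linear_mult[OF assms(1)]] .
  have "\<bar>(gauss_transfer p ^^ n) f x - gauss_density p x\<bar> \<le> L * Q_const p ^ n" for n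
  proof -
    define g where "g = (gauss_transfer p ^^ n) f"
    define c where "c = 1 / (ln (real p + 1) - ln (real p))"
    have gL: "(L * Q_const p ^ n)-lipschitz_on {0..1} (\<lambda>x. (real p + x) * g x)"
      and gI: "(g has_integral 1) {0..1}"
      using gauss_transfer_iterates[OF p L, of n] assms(2) unfolding g_def by auto
    have "((\<lambda>t. (real p + t) * g t / (real p + t)) has_integral 1) {0..1}"
      using gI p by (subst has_integral_cong[of _ _ g]) (auto simp: add_eq_0_iff)
    from weighted_mean_close[OF _ gL this x] p
    have b: "\<bar>(real p + x) * g x - c\<bar> \<le> L * Q_const p ^ n" by (simp add: c_def)
    have px: "real p + x \<ge> 1" using p x by auto
    have "1 * \<bar>g x - gauss_density p x\<bar> \<le> (real p + x) * \<bar>g x - gauss_density p x\<bar>"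
      using px by (intro mult_right_mono) auto
    also have "\<dots> = \<bar>(real p + x) * (g x - gauss_density p x)\<bar>"
      using px by (simp add: abs_mult)
    also have "(real p + x) * (g x - gauss_density p x) = (real p + x) * g x - c"
      using px by (simp add: gauss_density_def c_def right_diff_distrib)
    finally show ?thesis using b by (simp add: g_def)
  qed
  then show "\<exists>C. \<forall>n. \<bar>(gauss_transfer p ^^ n) f x - gauss_density p x\<bar> \<le> C * Q_const p ^ n"
    by blast
qed

end
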